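(* Let $\mathcal{P}\subseteq\mathbb{R}^I$ and $\mathcal{U}\subseteq\mathbb{R}^M$ be compact convex sets. Suppose that $R(\mathbf{p},\mathbf{u})$ is quasiconcave in $\mathbf{p}$ on $\mathcal{P}$ for any $\mathbf{u}\in\mathcal{U}$, quasiconvex in $\mathbf{u}$ on $\mathcal{U}$ for any $\mathbf{p}\in\mathcal{P}$, and continuous in $(\mathbf{p},\mathbf{u})$. Then the robust price optimization problem is randomization-proof, that is, $Z^*_{\mathrm{DR}} = Z^*_{\mathrm{RR}}$.
   Context: $\mathcal{P}$ is the (nonempty) set of feasible price vectors, $\mathcal{U}$ is the (nonempty) uncertainty set of demand parameters, and $R:\mathcal{P}\times\mathcal{U}\to\mathbb{R}$ is the revenue function. The deterministic and randomized robust price optimization problems have optimal values $$Z^*_{\mathrm{DR}} = \max_{\mathbf{p}\in\mathcal{P}} \min_{\mathbf{u}\in\mathcal{U}} R(\mathbf{p},\mathbf{u}),\qquad Z^*_{\mathrm{RR}} = \max_{F\in\mathcal{F}} \min_{\mathbf{u}\in\mathcal{U}} \int_{\mathcal{P}} R(\mathbf{p},\mathbf{u})\,dF(\mathbf{p}),$$ where $\mathcal{F}$ is the set of all probability distributions supported on $\mathcal{P}$. The robust price optimization problem is called randomization-proof if $Z^*_{\mathrm{RR}} = Z^*_{\mathrm{DR}}$. *)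

theory Defs
  imports "HOL-Probability.Probability"
begin

definition quasiconvex_on :: "'a::real_vector set \<Rightarrow> ('a \<Rightarrow> real) \<Rightarrow> bool"
  where "quasiconvex_on S f \<longleftrightarrow> convex S \<and>
    (\<forall>x\<in>S. \<forall>y\<in>S. \<forall>u\<ge>0. \<forall>v\<ge>0. u + v = 1 \<longrightarrow> f (u *\<^sub>R x + v *\<^sub>R y) \<le> max (f x) (f y))"

definition quasiconcave_on :: "'a::real_vector set \<Rightarrow> ('a \<Rightarrow> real) \<Rightarrow> bool"
  where "quasiconcave_on S f \<longleftrightarrow> quasiconvex_on S (\<lambda>x. - f x)"

lemma quasiconcave_on_iff:
  "quasiconcave_on S f \<longleftrightarrow> convex S \<and>
    (\<forall>x\<in>S. \<forall>y\<in>S. \<forall>u\<ge>0. \<forall>v\<ge>0. u + v = 1 \<longrightarrow> min (f x) (f y) \<le> f (u *\<^sub>R x + v *\<^sub>R y))"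
proof -
  have "(- f z \<le> max (- f x) (- f y)) = (min (f x) (f y) \<le> f z)" for x y z
    by (auto simp: max_def min_def)
  then show ?thesis
    by (simp only: quasiconcave_on_def quasiconvex_on_def)
qed

definition max_min :: "'a set \<Rightarrow> 'b set \<Rightarrow> ('a \<Rightarrow> 'b \<Rightarrow> real) \<Rightarrow> real"
  where "max_min A B f = (SUP a\<in>A. INF b\<in>B. f a b)"

text \<open>
  On the reals, suprema and infima of unbounded sets are unspecified. The following predicate says
  that the supremum and the infima in \<^const>\<open>max_min\<close> are a true maximum and true minima.
\<close>

definition max_min_attained :: "'a set \<Rightarrow> 'b set \<Rightarrow> ('a \<Rightarrow> 'b \<Rightarrow> real) \<Rightarrow> bool"
  where "max_min_attained A B f \<longleftrightarrow>
    (\<forall>a\<in>A. \<exists>b\<in>B. \<forall>b'\<in>B. f a b \<le> f a b') \<and>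
    (\<exists>a\<in>A. \<forall>a'\<in>A. (INF b\<in>B. f a' b) \<le> (INF b\<in>B. f a b))"

definition price_distributions :: "(real ^ 'i) set \<Rightarrow> (real ^ 'i) measure set"
  where "price_distributions P = {F. prob_space F \<and> sets F = sets borel \<and> measure F P = 1}"

definition expected_revenue ::
    "(real ^ 'i) set \<Rightarrow> (real ^ 'i \<Rightarrow> real ^ 'm \<Rightarrow> real) \<Rightarrow> (real ^ 'i) measure \<Rightarrow> real ^ 'm \<Rightarrow> real"
  where "expected_revenue P R F u = (LINT p:P|F. R p u)"

definition Z_DR :: "(real ^ 'i) set \<Rightarrow> (real ^ 'm) set \<Rightarrow> (real ^ 'i \<Rightarrow> real ^ 'm \<Rightarrow> real) \<Rightarrow> real"
  where "Z_DR P U R = max_min P U R"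

definition Z_RR :: "(real ^ 'i) set \<Rightarrow> (real ^ 'm) set \<Rightarrow> (real ^ 'i \<Rightarrow> real ^ 'm \<Rightarrow> real) \<Rightarrow> real"
  where "Z_RR P U R = max_min (price_distributions P) U (expected_revenue P R)"

definition randomization_proof ::
    "(real ^ 'i) set \<Rightarrow> (real ^ 'm) set \<Rightarrow> (real ^ 'i \<Rightarrow> real ^ 'm \<Rightarrow> real) \<Rightarrow> bool"
  where "randomization_proof P U R \<longleftrightarrow> Z_RR P U R = Z_DR P U R"

end

theory Submission
  imports Defs
begin

text \<open>
  By Sion's minimax theorem \<open>R\<close> has a saddle point \<open>(p\<^sub>0, u\<^sub>0)\<close>. Against \<open>u\<^sub>0\<close> no price vector, hence
  no distribution over price vectors, earns more than \<open>R p\<^sub>0 u\<^sub>0\<close>, and the point mass at \<open>p\<^sub>0\<close> secures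
  that much.

  The saddle point comes from Brouwer's theorem. If a level \<open>c\<close> separated the max-min from the
  min-max value, there would be continuous responses \<open>f : P \<rightarrow> U\<close> and \<open>g : U \<rightarrow> P\<close> with
  \<open>R p (f p) < c < R (g u) u\<close>, which is absurd at a fixed point of \<open>g \<circ> f\<close>.
\<close>

section \<open>Saddle points from Brouwer's theorem\<close>

lemma quasiconvex_on_strict_sublevel_convex:
  assumes "quasiconvex_on S f"
  shows "convex {x \<in> S. f x < c}"
proof (rule convexI)
  fix x y and u v :: real
  assume xy: "x \<in> {x \<in> S. f x < c}" "y \<in> {x \<in> S. f x < c}" and uv: "0 \<le> u" "0 \<le> v" "u + v = 1"
  have "u *\<^sub>R x + v *\<^sub>R y \<in> S"
    using assms xy uv unfolding quasiconvex_on_def by (auto intro: convexD)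
  moreover have "f (u *\<^sub>R x + v *\<^sub>R y) \<le> max (f x) (f y)"
    using assms xy uv unfolding quasiconvex_on_def by auto
  ultimately show "u *\<^sub>R x + v *\<^sub>R y \<in> {x \<in> S. f x < c}"
    using xy by auto
qed

text \<open>A partition of unity argument: by compactness finitely many points of \<open>U\<close>
  contain a reply to every \<open>p\<close>. Averaging them with continuous weights that vanish on
  all points that are not replies to \<open>p\<close> stays inside the convex set of
  replies.\<close>

lemma continuous_response:
  fixes R :: "'a::topological_space \<Rightarrow> 'b::real_normed_vector \<Rightarrow> real"
  assumes P: "compact P"
    and cont: "\<And>u. u \<in> U \<Longrightarrow> continuous_on P (\<lambda>p. R p u)"
    and conv: "\<And>p. p \<in> P \<Longrightarrow> convex {u \<in> U. R p u < c}"
    and ex: "\<And>p. p \<in> P \<Longrightarrow> \<exists>u\<in>U. R p u < c"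
  obtains f where "continuous_on P f" "\<And>p. p \<in> P \<Longrightarrow> f p \<in> U \<and> R p (f p) < c"
proof -
  have "\<exists>G. open G \<and> G \<inter> P = {p \<in> P. R p u < c}" if "u \<in> U" for u
  proof -
    have "\<exists>G. open G \<and> G \<inter> P = (\<lambda>p. R p u) -` {..<c} \<inter> P"
      using cont[OF that] by (meson continuous_on_open_invariant open_lessThan)
    then show ?thesis
      by (auto simp: set_eq_iff)
  qed
  then obtain G where G: "\<And>u. u \<in> U \<Longrightarrow> open (G u)"
      "\<And>u. u \<in> U \<Longrightarrow> G u \<inter> P = {p \<in> P. R p u < c}"
    by metis
  have "P \<subseteq> (\<Union>u\<in>U. G u)"
    using ex G(2) by blast
  then obtain D where D: "D \<subseteq> U" "finite D" "P \<subseteq> (\<Union>u\<in>D. G u)"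
    using compactE_image[OF P, of U G] G(1) by metis
  \<comment> \<open>The weight is continuous in \<open>p\<close> and positive exactly when
    \<open>R p u < c\<close>; the cover by the sets \<open>G u\<close> makes the normalising sum
    \<open>s p\<close> positive on \<open>P\<close>.\<close>
  define w where "w u p = max 0 (c - R p u)" for u p
  define s where "s p = (\<Sum>u\<in>D. w u p)" for p
  define f where "f p = (\<Sum>u\<in>D. (w u p / s p) *\<^sub>R u)" for p
  have w_nonneg: "0 \<le> w u p" for u p
    by (simp add: w_def)
  have s_pos: "0 < s p" if p: "p \<in> P" for p
  proof -
    obtain u where "u \<in> D" "p \<in> G u"
      using D(3) p by blast
    then have "R p u < c"
      using G(2)[of u] D(1) p by blast
    then have "0 < w u p"
      by (simp add: w_def)
    then show ?thesis
      unfolding s_def using \<open>u \<in> D\<close> D(2) w_nonneg by (intro sum_pos2[of D u])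
  qed
  have w_cont: "continuous_on P (w u)" if "u \<in> D" for u
    unfolding w_def using that D(1) by (auto intro!: continuous_intros cont)
  show thesis
  proof
    show "continuous_on P f"
      unfolding f_def s_def
    proof (intro continuous_intros w_cont)
      show "\<forall>p\<in>P. (\<Sum>u\<in>D. w u p) \<noteq> 0"
        using s_pos unfolding s_def by fastforce
    qed auto
    fix p assume p: "p \<in> P"
    \<comment> \<open>Points of weight zero lie outside the sublevel set, so its convexity can be
      applied only to the support of the weights.\<close>
    define E where "E = {u \<in> D. 0 < w u p}"
    have E: "finite E" "E \<subseteq> D"
      using D(2) by (auto simp: E_def)
    have 0: "w u p = 0" if "u \<in> D - E" for u
      using that w_nonneg[of u p] by (auto simp: E_def)
    have "f p = (\<Sum>u\<in>E. (w u p / s p) *\<^sub>R u)"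
      unfolding f_def using E D(2) 0 by (intro sum.mono_neutral_right) auto
    moreover have "(\<Sum>u\<in>E. w u p / s p) = 1"
    proof -
      have "s p = (\<Sum>u\<in>E. w u p)"
        unfolding s_def using E D(2) 0 by (intro sum.mono_neutral_right) auto
      then show ?thesis
        using s_pos[OF p] by (simp flip: sum_divide_distrib)
    qed
    moreover have "u \<in> {u \<in> U. R p u < c}" if "u \<in> E" for u
      using that D(1) by (auto simp: E_def w_def)
    ultimately have "f p \<in> {u \<in> U. R p u < c}"
      using convex_sum[OF E(1) conv[OF p], of "\<lambda>u. w u p / s p" "\<lambda>u. u"]
        w_nonneg s_pos[OF p] by (simp add: less_imp_le)
    then show "f p \<in> U \<and> R p (f p) < c"
      by simp
  qed
qed

text \<open>The minimax inequality, stated level by level. Both alternatives are weak inequalities,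
  so their failure supplies the strict ones that \<open>continuous_response\<close>
  requires.\<close>

lemma minimax_dichotomy:
  fixes R :: "'a::euclidean_space \<Rightarrow> 'b::real_normed_vector \<Rightarrow> real"
  assumes P: "P \<noteq> {}" "compact P" "convex P" and U: "compact U"
    and qc: "\<And>u. u \<in> U \<Longrightarrow> quasiconcave_on P (\<lambda>p. R p u)"
    and qv: "\<And>p. p \<in> P \<Longrightarrow> quasiconvex_on U (\<lambda>u. R p u)"
    and cp: "\<And>u. u \<in> U \<Longrightarrow> continuous_on P (\<lambda>p. R p u)"
    and cu: "\<And>p. p \<in> P \<Longrightarrow> continuous_on U (\<lambda>u. R p u)"
  shows "(\<exists>p\<in>P. \<forall>u\<in>U. c \<le> R p u) \<or> (\<exists>u\<in>U. \<forall>p\<in>P. R p u \<le> c)"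
proof (rule ccontr)
  assume neg: "\<not> ?thesis"
  obtain f where f: "continuous_on P f" "\<And>p. p \<in> P \<Longrightarrow> f p \<in> U \<and> R p (f p) < c"
  proof (rule continuous_response[of P U R c])
    show "\<exists>u\<in>U. R p u < c" if "p \<in> P" for p
      using neg that by (auto simp: not_le)
    show "convex {u \<in> U. R p u < c}" if "p \<in> P" for p
      using quasiconvex_on_strict_sublevel_convex qv[OF that] by blast
  qed (use P cp in auto)
  \<comment> \<open>The roles of the players are swapped by negating \<open>R\<close>, which turns
    quasiconcavity in \<open>p\<close> into quasiconvexity.\<close>
  obtain g where g: "continuous_on U g" "\<And>u. u \<in> U \<Longrightarrow> g u \<in> P \<and> - R (g u) u < - c"
  proof (rule continuous_response[of U P "\<lambda>u p. - R p u" "- c"])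
    show "\<exists>p\<in>P. - R p u < - c" if "u \<in> U" for u
      using neg that by (auto simp: not_le)
    show "convex {p \<in> P. - R p u < - c}" if "u \<in> U" for u
      using quasiconvex_on_strict_sublevel_convex qc[OF that] unfolding quasiconcave_on_def by blast
  qed (use U cu in \<open>auto intro!: continuous_intros\<close>)
  have "continuous_on P (g \<circ> f)"
    using f g by (intro continuous_on_compose continuous_on_subset[OF g(1)]) auto
  moreover have "g \<circ> f \<in> P \<rightarrow> P"
    using f g by auto
  ultimately obtain p where "p \<in> P" "(g \<circ> f) p = p"
    using brouwer[OF P(2,3,1)] by blast
  \<comment> \<open>With \<open>u = f p\<close> and \<open>p = g u\<close>, the two responses give
    \<open>R p u < c\<close> and \<open>c < R p u\<close>.\<close>
  then show False
    using f(2)[of p] g(2)[of "f p"] by auto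
qed

text \<open>A limit point of choices securing levels that increase to \<open>v\<close> secures
  \<open>v\<close> itself. The subsequence is chosen before \<open>u\<close>, so one limit serves
  all \<open>u\<close>.\<close>

lemma compact_attains_level:
  fixes R :: "'a::first_countable_topology \<Rightarrow> 'b \<Rightarrow> real"
  assumes P: "compact P" and cont: "\<And>u. u \<in> U \<Longrightarrow> continuous_on P (\<lambda>p. R p u)"
    and ex: "\<And>c. c < v \<Longrightarrow> \<exists>p\<in>P. \<forall>u\<in>U. c \<le> R p u"
  shows "\<exists>p\<in>P. \<forall>u\<in>U. v \<le> R p u"
proof -
  \<comment> \<open>\<open>Suc\<close> keeps the level strictly below \<open>v\<close>: as
    \<open>inverse 0 = 0\<close>, the index 0 would otherwise ask for \<open>v\<close>
    itself.\<close>
  have "\<exists>p\<in>P. \<forall>u\<in>U. v - inverse (real (Suc n)) \<le> R p u" for n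
    by (rule ex) simp
  then obtain X where X: "\<And>n. X n \<in> P" "\<And>n u. u \<in> U \<Longrightarrow> v - inverse (real (Suc n)) \<le> R (X n) u"
    by metis
  obtain p r where p: "p \<in> P" "strict_mono r" "(X \<circ> r) \<longlonglongrightarrow> p"
    using compact_imp_seq_compact[OF P] X(1) unfolding seq_compact_def by metis
  have "v \<le> R p u" if "u \<in> U" for u
  proof (rule LIMSEQ_le)
    show "(\<lambda>n. R ((X \<circ> r) n) u) \<longlonglongrightarrow> R p u"
      using continuous_on_tendsto_compose[OF cont[OF that] p(3,1)] X(1) by simp
    have "(\<lambda>n. v - inverse (real (Suc n))) \<longlonglongrightarrow> v - 0"
      by (intro tendsto_intros LIMSEQ_inverse_real_of_nat)
    then show "(\<lambda>n. v - inverse (real (Suc (r n)))) \<longlonglongrightarrow> v"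
      using LIMSEQ_subseq_LIMSEQ[OF _ p(2)] by (fastforce simp: o_def)
    show "\<exists>N. \<forall>n\<ge>N. v - inverse (real (Suc (r n))) \<le> R ((X \<circ> r) n) u"
      using X(2)[OF that] by auto
  qed
  then show ?thesis
    using p(1) by blast
qed

lemma saddle_point_exists:
  fixes R :: "'a::euclidean_space \<Rightarrow> 'b::real_normed_vector \<Rightarrow> real"
  assumes P: "P \<noteq> {}" "compact P" "convex P" and U: "U \<noteq> {}" "compact U"
    and qc: "\<And>u. u \<in> U \<Longrightarrow> quasiconcave_on P (\<lambda>p. R p u)"
    and qv: "\<And>p. p \<in> P \<Longrightarrow> quasiconvex_on U (\<lambda>u. R p u)"
    and cp: "\<And>u. u \<in> U \<Longrightarrow> continuous_on P (\<lambda>p. R p u)"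
    and cu: "\<And>p. p \<in> P \<Longrightarrow> continuous_on U (\<lambda>u. R p u)"
  obtains p\<^sub>0 u\<^sub>0 where "p\<^sub>0 \<in> P" "u\<^sub>0 \<in> U"
    "\<And>u. u \<in> U \<Longrightarrow> R p\<^sub>0 u\<^sub>0 \<le> R p\<^sub>0 u" "\<And>p. p \<in> P \<Longrightarrow> R p u\<^sub>0 \<le> R p\<^sub>0 u\<^sub>0"
proof -
  \<comment> \<open>\<open>A\<close> collects the levels that some price guarantees, so
    \<open>v\<close> is the max-min value. The minimum at \<open>p'\<close> is a member and the
    maximum against \<open>u'\<close> an upper bound, which makes \<open>Sup A\<close>
    meaningful.\<close>
  define A where "A = {c. \<exists>p\<in>P. \<forall>u\<in>U. c \<le> R p u}"
  define v where "v = Sup A"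
  obtain p' u' where pu': "p' \<in> P" "u' \<in> U"
    using P U by blast
  obtain b where b: "b \<in> P" "\<And>p. p \<in> P \<Longrightarrow> R p u' \<le> R b u'"
    using continuous_attains_sup[OF P(2,1) cp[OF pu'(2)]] by blast
  obtain a where a: "a \<in> U" "\<And>u. u \<in> U \<Longrightarrow> R p' a \<le> R p' u"
    using continuous_attains_inf[OF U(2,1) cu[OF pu'(1)]] by blast
  have A_ne: "A \<noteq> {}"
    using a pu' by (auto simp: A_def)
  have A_bdd: "bdd_above A"
    unfolding A_def bdd_above_def using b(2) pu'(2) by (blast intro: order_trans)
  have "\<exists>p\<in>P. \<forall>u\<in>U. v \<le> R p u"
  proof (rule compact_attains_level)
    fix c assume "c < v"
    then obtain d where "d \<in> A" "c < d"
      using less_cSup_iff[OF A_ne A_bdd] unfolding v_def by auto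
    then show "\<exists>p\<in>P. \<forall>u\<in>U. c \<le> R p u"
      unfolding A_def by (blast intro: order_trans less_imp_le)
  qed (use P cp in auto)
  then obtain p\<^sub>0 where p0: "p\<^sub>0 \<in> P" "\<And>u. u \<in> U \<Longrightarrow> v \<le> R p\<^sub>0 u"
    by blast
  \<comment> \<open>No price guarantees a level above \<open>v\<close>, so the dichotomy yields a
    \<open>u\<close> capping \<open>R\<close> there; the compactness argument for \<open>- R\<close>
    brings the cap down to \<open>v\<close>.\<close>
  have "\<exists>u\<in>U. \<forall>p\<in>P. - v \<le> - R p u"
  proof (rule compact_attains_level)
    fix c assume "c < - v"
    then have "- c \<notin> A"
      using cSup_upper[OF _ A_bdd, of "- c"] by (auto simp: v_def)
    then have "\<exists>u\<in>U. \<forall>p\<in>P. R p u \<le> - c"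
      using minimax_dichotomy[OF P U(2) qc qv cp cu, of "- c"] by (auto simp: A_def)
    then show "\<exists>u\<in>U. \<forall>p\<in>P. c \<le> - R p u"
      by (auto simp: le_minus_iff)
  qed (use U cu in \<open>auto intro!: continuous_intros\<close>)
  then obtain u\<^sub>0 where u0: "u\<^sub>0 \<in> U" "\<And>p. p \<in> P \<Longrightarrow> R p u\<^sub>0 \<le> v"
    by auto
  have "R p\<^sub>0 u\<^sub>0 = v"
    using p0 u0 by (meson antisym)
  then show thesis
    using that p0 u0 by simp
qed

text \<open>\<open>a\<^sub>0\<close> guarantees \<open>v\<close> and \<open>b\<^sub>0\<close> caps
  every choice at \<open>v\<close>. Keeping \<open>v\<close> a free number lets the deterministic
  and the randomized problem be evaluated at the same value. The minima in \<open>min\<close> bound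
  each inner infimum from below, so that it is a genuine one.\<close>

lemma max_min_saddle_point:
  assumes min: "\<And>a. a \<in> A \<Longrightarrow> \<exists>b\<in>B. \<forall>b'\<in>B. f a b \<le> f a b'"
    and ab: "a\<^sub>0 \<in> A" "b\<^sub>0 \<in> B"
    and saddle: "\<And>b. b \<in> B \<Longrightarrow> v \<le> f a\<^sub>0 b" "\<And>a. a \<in> A \<Longrightarrow> f a b\<^sub>0 \<le> v"
  shows "max_min_attained A B f" and "max_min A B f = v"
proof -
  have le: "(INF b\<in>B. f a b) \<le> v" if "a \<in> A" for a
  proof -
    have "bdd_below (f a ` B)"
      using min[OF that] by (auto simp: bdd_below_def)
    then show ?thesis
      using ab(2) saddle(2)[OF that] by (rule cINF_lower2)
  qed
  have eq: "(INF b\<in>B. f a\<^sub>0 b) = v"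
    using le[OF ab(1)] saddle(1) ab(2) by (intro antisym cINF_greatest) auto
  show "max_min_attained A B f"
    unfolding max_min_attained_def using min le eq ab(1) by auto
  show "max_min A B f = v"
    unfolding max_min_def using le eq ab(1) by (intro cSup_eq_maximum) auto
qed

section \<open>Expected revenue under a price distribution\<close>

lemma expected_revenue_integrable:
  fixes P :: "(real ^ 'i) set" and R :: "real ^ 'i \<Rightarrow> real ^ 'm \<Rightarrow> real"
  assumes P: "compact P" and F: "F \<in> price_distributions P"
    and cont: "continuous_on P (\<lambda>p. R p u)"
  shows "set_integrable F P (\<lambda>p. R p u)"
proof -
  interpret prob_space F
    using F by (simp add: price_distributions_def)
  have [measurable_cong]: "sets F = sets borel"
    using F by (simp add: price_distributions_def)
  obtain K where K: "\<And>p. p \<in> P \<Longrightarrow> \<bar>R p u\<bar> \<le> K" "0 \<le> K"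
    using compact_imp_bounded[OF compact_continuous_image[OF cont P]]
    by (force simp: bounded_pos)
  \<comment> \<open>\<open>R\<close> is arbitrary outside \<open>P\<close>; the indicator cuts it
    off there.\<close>
  have "(\<lambda>p. indicator P p *\<^sub>R R p u) \<in> borel_measurable borel"
    using P cont by (intro borel_measurable_continuous_on_indicator) (auto simp: borel_compact)
  then have "(\<lambda>p. indicator P p *\<^sub>R R p u) \<in> borel_measurable F"
    by measurable
  then show ?thesis
    unfolding set_integrable_def using K
    by (intro integrable_const_bound[where B = K]) (auto simp: indicator_def)
qed

text \<open>Dominated convergence. Continuity on the compact \<open>U\<close> makes the inner
  minimum of the randomized problem attained for every distribution.\<close>

lemma expected_revenue_continuous:
  fixes P :: "(real ^ 'i) set" and U :: "(real ^ 'm) set"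
  assumes P: "compact P" and U: "compact U" and F: "F \<in> price_distributions P"
    and cont: "continuous_on (P \<times> U) (\<lambda>(p, u). R p u)"
    and cp: "\<And>u. u \<in> U \<Longrightarrow> continuous_on P (\<lambda>p. R p u)"
    and cu: "\<And>p. p \<in> P \<Longrightarrow> continuous_on U (\<lambda>u. R p u)"
  shows "continuous_on U (expected_revenue P R F)"
proof -
  interpret prob_space F
    using F by (simp add: price_distributions_def)
  \<comment> \<open>The dominating constant must be uniform in \<open>u\<close>, hence joint
    continuity on the compact product.\<close>
  obtain K where K: "\<And>p u. p \<in> P \<Longrightarrow> u \<in> U \<Longrightarrow> \<bar>R p u\<bar> \<le> K" "0 \<le> K"
    using compact_imp_bounded[OF compact_continuous_image[OF cont compact_Times[OF P U]]]
    by (force simp: bounded_pos)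
  have meas: "(\<lambda>p. indicator P p *\<^sub>R R p u) \<in> borel_measurable F" if "u \<in> U" for u
    using expected_revenue_integrable[where R = R, OF P F cp[OF that]]
    unfolding set_integrable_def by (rule borel_measurable_integrable)
  show ?thesis
    unfolding continuous_on_sequentially
  proof (intro ballI allI impI; elim conjE)
    fix u X assume u: "u \<in> U" and X: "\<forall>n. X n \<in> U" "X \<longlonglongrightarrow> u"
    have "(\<lambda>n. LINT p|F. indicator P p *\<^sub>R R p (X n)) \<longlonglongrightarrow> (LINT p|F. indicator P p *\<^sub>R R p u)"
    proof (rule integral_dominated_convergence[where w = "\<lambda>_. K"])
      show "AE p in F. (\<lambda>n. indicator P p *\<^sub>R R p (X n)) \<longlonglongrightarrow> indicator P p *\<^sub>R R p u"
      proof (rule AE_I2)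
        fix p
        show "(\<lambda>n. indicator P p *\<^sub>R R p (X n)) \<longlonglongrightarrow> indicator P p *\<^sub>R R p u"
          using continuous_on_tendsto_compose[OF cu X(2) u] X(1)
          by (cases "p \<in> P") auto
      qed
      show "AE p in F. norm (indicator P p *\<^sub>R R p (X n)) \<le> K" for n
        using K X(1) by (intro AE_I2) (auto simp: indicator_def)
    qed (use meas u X in auto)
    then show "(expected_revenue P R F \<circ> X) \<longlonglongrightarrow> expected_revenue P R F u"
      by (simp add: expected_revenue_def set_lebesgue_integral_def o_def)
  qed
qed

lemma expected_revenue_le:
  fixes P :: "(real ^ 'i) set" and R :: "real ^ 'i \<Rightarrow> real ^ 'm \<Rightarrow> real"
  assumes P: "compact P" and F: "F \<in> price_distributions P"
    and cont: "continuous_on P (\<lambda>p. R p u)"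
    and le: "\<And>p. p \<in> P \<Longrightarrow> R p u \<le> v"
  shows "expected_revenue P R F u \<le> v"
proof -
  interpret prob_space F
    using F by (simp add: price_distributions_def)
  have PF: "P \<in> sets F"
    using F P by (simp add: price_distributions_def borel_compact)
  have "set_integrable F P (\<lambda>_. v)"
    unfolding set_integrable_def using PF by (intro integrable_const_bound[where B = "\<bar>v\<bar>"]) (auto simp: indicator_def)
  then have "(LINT p:P|F. R p u) \<le> (LINT p:P|F. v)"
    using expected_revenue_integrable[where R = R, OF P F cont] le by (intro set_integral_mono)
  \<comment> \<open>The integral is \<open>v\<close> times the mass of \<open>P\<close>, which is
    1.\<close>
  also have "\<dots> = v"
    using F PF by (simp add: set_lebesgue_integral_def price_distributions_def Int_absorb2[OF sets.sets_into_space])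
  finally show ?thesis
    by (simp add: expected_revenue_def)
qed

lemma point_mass_price_distribution:
  assumes "p \<in> P" and "compact P"
  shows "return borel p \<in> price_distributions P"
  using assms
  by (simp add: price_distributions_def prob_space_return measure_return borel_compact)

lemma expected_revenue_point_mass:
  fixes P :: "(real ^ 'i) set" and R :: "real ^ 'i \<Rightarrow> real ^ 'm \<Rightarrow> real"
  assumes "compact P" and "p \<in> P" and cont: "continuous_on P (\<lambda>p. R p u)"
  shows "expected_revenue P R (return borel p) u = R p u"
proof -
  have "(\<lambda>p. indicator P p *\<^sub>R R p u) \<in> borel_measurable borel"
    using assms by (intro borel_measurable_continuous_on_indicator) (auto simp: borel_compact)
  then show ?thesis
    unfolding expected_revenue_def set_lebesgue_integral_def
    using assms(2) by (subst integral_return) auto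
qed

theorem theorem2:
  fixes P :: "(real ^ 'i) set"
    and U :: "(real ^ 'm) set"
    and R :: "real ^ 'i \<Rightarrow> real ^ 'm \<Rightarrow> real"
  assumes "P \<noteq> {}" and "compact P" and "convex P"
    and "U \<noteq> {}" and "compact U" and "convex U"
    and "\<And>u. u \<in> U \<Longrightarrow> quasiconcave_on P (\<lambda>p. R p u)"
    and "\<And>p. p \<in> P \<Longrightarrow> quasiconvex_on U (\<lambda>u. R p u)"
    and "continuous_on (P \<times> U) (\<lambda>(p, u). R p u)"
  shows "max_min_attained P U R
    \<and> max_min_attained (price_distributions P) U (expected_revenue P R)
    \<and> randomization_proof P U R"
proof -
  have cp: "continuous_on P (\<lambda>p. R p u)" if "u \<in> U" for u
  proof -
    have "continuous_on P (\<lambda>p. (p, u))"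
      by (intro continuous_intros)
    from continuous_on_compose2[OF assms(9) this] show ?thesis
      using that by auto
  qed
  have cu: "continuous_on U (\<lambda>u. R p u)" if "p \<in> P" for p
  proof -
    have "continuous_on U (\<lambda>u. (p, u))"
      by (intro continuous_intros)
    from continuous_on_compose2[OF assms(9) this] show ?thesis
      using that by auto
  qed
  obtain p\<^sub>0 u\<^sub>0 where s: "p\<^sub>0 \<in> P" "u\<^sub>0 \<in> U"
    "\<And>u. u \<in> U \<Longrightarrow> R p\<^sub>0 u\<^sub>0 \<le> R p\<^sub>0 u" "\<And>p. p \<in> P \<Longrightarrow> R p u\<^sub>0 \<le> R p\<^sub>0 u\<^sub>0"
    using saddle_point_exists[OF assms(1-5,7,8) cp cu] by blast
  have min_DR: "\<exists>u\<in>U. \<forall>u'\<in>U. R p u \<le> R p u'" if "p \<in> P" for p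
    using continuous_attains_inf[OF assms(5,4) cu[OF that]] .
  have min_RR: "\<exists>u\<in>U. \<forall>u'\<in>U. expected_revenue P R F u \<le> expected_revenue P R F u'"
    if "F \<in> price_distributions P" for F
    using assms that cp cu
    by (intro continuous_attains_inf expected_revenue_continuous)
  have point_mass: "R p\<^sub>0 u\<^sub>0 \<le> expected_revenue P R (return borel p\<^sub>0) u" if "u \<in> U" for u
    using expected_revenue_point_mass[where R = R, OF assms(2) s(1) cp[OF that]] s(3)[OF that] by simp
  have mixed: "expected_revenue P R F u\<^sub>0 \<le> R p\<^sub>0 u\<^sub>0" if "F \<in> price_distributions P" for F
    using expected_revenue_le[where R = R, OF assms(2) that cp[OF s(2)] s(4)] .
  \<comment> \<open>The point mass at \<open>p\<^sub>0\<close> and \<open>u\<^sub>0\<close> take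
    over the saddle point's role in the randomized problem, with the same value
    \<open>R p\<^sub>0 u\<^sub>0\<close>; so the two optimal values agree.\<close>
  note DR = max_min_saddle_point[where f = R, OF min_DR s]
  note RR = max_min_saddle_point[where f = "expected_revenue P R",
      OF min_RR point_mass_price_distribution[OF s(1) assms(2)] s(2) point_mass mixed]
  show ?thesis
    using DR RR by (simp add: randomization_proof_def Z_DR_def Z_RR_def)
qed

end
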